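(* Let $(M,d)$ be a complete and separable metric space, and let $(\mathcal{M},\pi)$ be the metric space of all probability measures on the Borel $\sigma$-field of $M$, with $\pi$ the Prohorov metric. A family $\mathcal{F}\subset\mathcal{M}$ is tight if and only if its closure in $(\mathcal{M},\pi)$ is compact.
   Context: For $A\subset M$ and $\varepsilon>0$, $A^{\varepsilon}=\{x\in M : \exists\, y\in A \text{ with } d(x,y)<\varepsilon\}$. The Prohorov metric on $\mathcal{M}$ is $$\pi(\mu,\nu)=\inf\{\varepsilon>0 : \mu(A)\le\nu(A^{\varepsilon})+\varepsilon \text{ and } \nu(A)\le\mu(A^{\varepsilon})+\varepsilon \text{ for all closed sets } A\subset M\}.$$ A family $\mathcal{F}$ of probability measures on the Borel $\sigma$-field of $M$ is tight if for every $\varepsilon>0$ there is a compact set $K_{\varepsilon}\subset M$ such that $\mu(K_{\varepsilon})>1-\varepsilon$ for every $\mu\in\mathcal{F}$. *)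

theory Defs
  imports "HOL-Probability.Probability"
begin

definition enlargement :: "'a::metric_space set \<Rightarrow> real \<Rightarrow> 'a set" where
  "enlargement A \<epsilon> = {x. \<exists>y\<in>A. dist x y < \<epsilon>}"

definition prohorov_admissible :: "'a::metric_space measure \<Rightarrow> 'a measure \<Rightarrow> real \<Rightarrow> bool" where
  "prohorov_admissible \<mu> \<nu> \<epsilon> \<longleftrightarrow>
     0 < \<epsilon> \<and>
     (\<forall>A. closed A \<longrightarrow> measure \<mu> A \<le> measure \<nu> (enlargement A \<epsilon>) + \<epsilon> \<and>
                      measure \<nu> A \<le> measure \<mu> (enlargement A \<epsilon>) + \<epsilon>)"

definition prohorov :: "'a::metric_space measure \<Rightarrow> 'a measure \<Rightarrow> real" where
  "prohorov \<mu> \<nu> = Inf {\<epsilon>. prohorov_admissible \<mu> \<nu> \<epsilon>}"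

text \<open>
  Borel probability measures form a type of their own, so that the Prohorov metric can be its
  \<^class>\<open>metric_space\<close> structure; closure and compactness are then the library notions.
  The infimum in \<^const>\<open>prohorov\<close> is over a nonempty set for such measures
  (\<open>\<epsilon> = 1\<close> is always admissible), but may be junk for arbitrary measures.
  Since HOL types are nonempty, only nonempty underlying spaces are considered; an empty one
  carries no probability measure.
\<close>

typedef (overloaded) 'a borel_prob =
  "{\<mu> :: 'a::topological_space measure. prob_space \<mu> \<and> sets \<mu> = sets borel}"
  morphisms borel_measure Abs_borel_prob
proof
  show "return borel undefined \<in> {\<mu> :: 'a measure. prob_space \<mu> \<and> sets \<mu> = sets borel}"
    by (auto intro: prob_space_return)
qed

lemma prob_space_borel_measure: "prob_space (borel_measure \<mu>)"
  and sets_borel_measure [simp, measurable_cong]: "sets (borel_measure \<mu>) = sets borel"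
  and space_borel_measure [simp]: "space (borel_measure \<mu>) = UNIV"
proof -
  show "prob_space (borel_measure \<mu>)" and *: "sets (borel_measure \<mu>) = sets borel"
    using borel_measure[of \<mu>] by auto
  show "space (borel_measure \<mu>) = UNIV"
    using sets_eq_imp_space_eq[OF *] by simp
qed

lemma enlargement_eq: "enlargement A \<epsilon> = (\<Union>y\<in>A. ball y \<epsilon>)"
  by (auto simp: enlargement_def dist_commute)

lemma open_enlargement: "open (enlargement A \<epsilon>)"
  by (auto simp: enlargement_eq)

lemma enlargement_mono: "\<epsilon> \<le> \<delta> \<Longrightarrow> enlargement A \<epsilon> \<subseteq> enlargement A \<delta>"
  unfolding enlargement_def by (blast intro: less_le_trans)

lemma subset_enlargement: "0 < \<epsilon> \<Longrightarrow> A \<subseteq> enlargement A \<epsilon>"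
  by (auto simp: enlargement_def intro!: bexI)

lemma enlargement_closure_enlargement:
  assumes "0 < \<delta>"
  shows "enlargement (closure (enlargement A \<epsilon>)) \<delta> \<subseteq> enlargement A (\<epsilon> + \<delta>)"
proof
  fix x assume "x \<in> enlargement (closure (enlargement A \<epsilon>)) \<delta>"
  then obtain y where y: "y \<in> closure (enlargement A \<epsilon>)" "dist x y < \<delta>"
    by (auto simp: enlargement_def)
  from y obtain z where z: "z \<in> enlargement A \<epsilon>" "dist z y < \<delta> - dist x y"
    by (metis closure_approachable diff_gt_0_iff_gt)
  from z obtain a where a: "a \<in> A" "dist z a < \<epsilon>"
    by (auto simp: enlargement_def)
  have "dist x a < \<epsilon> + \<delta>"
    using a z dist_triangle[of x a z] dist_triangle[of x z y] by (simp add: dist_commute)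
  with a show "x \<in> enlargement A (\<epsilon> + \<delta>)"
    by (auto simp: enlargement_def)
qed

lemma prohorov_admissible_commute: "prohorov_admissible \<mu> \<nu> \<epsilon> \<longleftrightarrow> prohorov_admissible \<nu> \<mu> \<epsilon>"
  by (auto simp: prohorov_admissible_def)

lemma prohorov_commute: "prohorov \<mu> \<nu> = prohorov \<nu> \<mu>"
  by (simp add: prohorov_def prohorov_admissible_commute)

lemma bdd_below_prohorov_admissible: "bdd_below {\<epsilon>. prohorov_admissible \<mu> \<nu> \<epsilon>}"
  by (rule bdd_belowI[of _ 0]) (auto simp: prohorov_admissible_def)

context
  fixes \<mu> \<nu> \<rho> :: "'a::metric_space borel_prob"
begin

interpretation M: prob_space "borel_measure \<mu>" by (rule prob_space_borel_measure)
interpretation N: prob_space "borel_measure \<nu>" by (rule prob_space_borel_measure)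
interpretation R: prob_space "borel_measure \<rho>" by (rule prob_space_borel_measure)

lemma prohorov_admissible_1: "prohorov_admissible (borel_measure \<mu>) (borel_measure \<nu>) 1"
  unfolding prohorov_admissible_def
  using M.prob_le_1 N.prob_le_1 by (auto intro!: add_increasing)

lemma prohorov_admissible_add:
  assumes "prohorov_admissible (borel_measure \<mu>) (borel_measure \<nu>) \<epsilon>"
    and "prohorov_admissible (borel_measure \<nu>) (borel_measure \<rho>) \<delta>"
  shows "prohorov_admissible (borel_measure \<mu>) (borel_measure \<rho>) (\<epsilon> + \<delta>)"
proof -
  have pos: "0 < \<epsilon>" "0 < \<delta>"
    using assms by (auto simp: prohorov_admissible_def)
  have "measure (borel_measure \<mu>) A \<le> measure (borel_measure \<rho>) (enlargement A (\<epsilon> + \<delta>)) + (\<epsilon> + \<delta>)"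
    if "closed A" for A
  proof -
    have "measure (borel_measure \<mu>) A \<le> measure (borel_measure \<nu>) (enlargement A \<epsilon>) + \<epsilon>"
      using assms that by (auto simp: prohorov_admissible_def)
    also have "measure (borel_measure \<nu>) (enlargement A \<epsilon>)
        \<le> measure (borel_measure \<nu>) (closure (enlargement A \<epsilon>))"
      by (intro N.finite_measure_mono closure_subset) auto
    also have "\<dots> \<le> measure (borel_measure \<rho>) (enlargement (closure (enlargement A \<epsilon>)) \<delta>) + \<delta>"
      using assms by (auto simp: prohorov_admissible_def)
    also have "measure (borel_measure \<rho>) (enlargement (closure (enlargement A \<epsilon>)) \<delta>)
        \<le> measure (borel_measure \<rho>) (enlargement A (\<epsilon> + \<delta>))"
      by (intro R.finite_measure_mono enlargement_closure_enlargement pos)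
        (auto intro!: borel_open open_enlargement)
    finally show ?thesis by simp
  qed
  moreover have "measure (borel_measure \<rho>) A \<le> measure (borel_measure \<mu>) (enlargement A (\<epsilon> + \<delta>)) + (\<epsilon> + \<delta>)"
    if "closed A" for A
  proof -
    have "measure (borel_measure \<rho>) A \<le> measure (borel_measure \<nu>) (enlargement A \<delta>) + \<delta>"
      using assms that by (auto simp: prohorov_admissible_def)
    also have "measure (borel_measure \<nu>) (enlargement A \<delta>)
        \<le> measure (borel_measure \<nu>) (closure (enlargement A \<delta>))"
      by (intro N.finite_measure_mono closure_subset) auto
    also have "\<dots> \<le> measure (borel_measure \<mu>) (enlargement (closure (enlargement A \<delta>)) \<epsilon>) + \<epsilon>"
      using assms by (auto simp: prohorov_admissible_def)
    also have "measure (borel_measure \<mu>) (enlargement (closure (enlargement A \<delta>)) \<epsilon>)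
        \<le> measure (borel_measure \<mu>) (enlargement A (\<delta> + \<epsilon>))"
      by (intro M.finite_measure_mono enlargement_closure_enlargement pos)
        (auto intro!: borel_open open_enlargement)
    finally show ?thesis by (simp add: add.commute)
  qed
  ultimately show ?thesis
    using pos by (auto simp: prohorov_admissible_def)
qed

end

lemma prohorov_lessD:
  assumes "prohorov (borel_measure \<mu>) (borel_measure \<nu>) < e"
  obtains \<epsilon> where "prohorov_admissible (borel_measure \<mu>) (borel_measure \<nu>) \<epsilon>" "\<epsilon> < e"
proof -
  have "{\<epsilon>. prohorov_admissible (borel_measure \<mu>) (borel_measure \<nu>) \<epsilon>} \<noteq> {}"
    using prohorov_admissible_1 by auto
  from cInf_lessD[OF this assms[unfolded prohorov_def]] that show thesis
    by auto
qed

lemma prohorov_le: "prohorov_admissible \<mu> \<nu> \<epsilon> \<Longrightarrow> prohorov \<mu> \<nu> \<le> \<epsilon>"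
  unfolding prohorov_def by (intro cInf_lower bdd_below_prohorov_admissible) auto

lemma prohorov_triangle:
  "prohorov (borel_measure \<mu>) (borel_measure \<rho>)
     \<le> prohorov (borel_measure \<mu>) (borel_measure \<nu>) + prohorov (borel_measure \<nu>) (borel_measure \<rho>)"
  (is "?c \<le> ?a + ?b")
proof (rule field_le_epsilon)
  fix e :: real assume "0 < e"
  obtain \<epsilon> where 1: "prohorov_admissible (borel_measure \<mu>) (borel_measure \<nu>) \<epsilon>" "\<epsilon> < ?a + e / 2"
    using prohorov_lessD[of \<mu> \<nu> "?a + e / 2"] \<open>0 < e\<close> by auto
  obtain \<delta> where 2: "prohorov_admissible (borel_measure \<nu>) (borel_measure \<rho>) \<delta>" "\<delta> < ?b + e / 2"
    using prohorov_lessD[of \<nu> \<rho> "?b + e / 2"] \<open>0 < e\<close> by auto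
  show "?c \<le> ?a + ?b + e"
    using prohorov_le[OF prohorov_admissible_add[OF 1(1) 2(1)]] 1(2) 2(2) by simp
qed

lemma enlargement_tendsto:
  fixes \<nu> :: "'a::metric_space borel_prob"
  assumes "closed A"
  shows "(\<lambda>n. measure (borel_measure \<nu>) (enlargement A (1 / Suc n)))
           \<longlonglongrightarrow> measure (borel_measure \<nu>) A"
proof -
  interpret N: prob_space "borel_measure \<nu>" by (rule prob_space_borel_measure)
  have "decseq (\<lambda>n. enlargement A (1 / Suc n))"
  proof (rule decseq_SucI)
    fix n
    have "1 / real (Suc (Suc n)) \<le> 1 / real (Suc n)" by (simp add: field_simps)
    then show "enlargement A (1 / Suc (Suc n)) \<subseteq> enlargement A (1 / Suc n)"
      unfolding enlargement_def by (blast intro: less_le_trans)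
  qed
  moreover have "(\<Inter>n. enlargement A (1 / Suc n)) = A"
  proof (intro antisym subsetI)
    fix x assume x: "x \<in> (\<Inter>n. enlargement A (1 / Suc n))"
    have "x \<in> closure A"
      unfolding closure_approachable
    proof (intro allI impI)
      fix e :: real assume "0 < e"
      then obtain n where n: "1 / Suc n < e" using nat_approx_posE by blast
      from x obtain y where "y \<in> A" "dist x y < 1 / Suc n"
        by (auto simp: enlargement_def)
      with n show "\<exists>y\<in>A. dist y x < e"
        by (auto simp: dist_commute intro!: bexI[of _ y])
    qed
    with assms show "x \<in> A" by simp
  next
    fix x assume "x \<in> A"
    then show "x \<in> (\<Inter>n. enlargement A (1 / Suc n))"
      by (auto simp: enlargement_def intro!: bexI[of _ x])
  qed
  ultimately show ?thesis
    using N.finite_Lim_measure_decseq[of "\<lambda>n. enlargement A (1 / Suc n)"]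
    by (auto intro: borel_open open_enlargement)
qed

lemma prohorov_eq_0_closed:
  assumes "prohorov (borel_measure \<mu>) (borel_measure \<nu>) = 0" "closed A"
  shows "measure (borel_measure \<mu>) A \<le> measure (borel_measure \<nu>) A"
proof -
  interpret N: prob_space "borel_measure \<nu>" by (rule prob_space_borel_measure)
  have "measure (borel_measure \<mu>) A
      \<le> measure (borel_measure \<nu>) (enlargement A (1 / Suc n)) + 1 / Suc n" for n
  proof -
    obtain \<epsilon> where \<epsilon>: "prohorov_admissible (borel_measure \<mu>) (borel_measure \<nu>) \<epsilon>" "\<epsilon> < 1 / Suc n"
      using prohorov_lessD[of \<mu> \<nu> "1 / Suc n"] assms(1) by auto
    have "measure (borel_measure \<mu>) A \<le> measure (borel_measure \<nu>) (enlargement A \<epsilon>) + \<epsilon>"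
      using \<epsilon>(1) assms(2) by (auto simp: prohorov_admissible_def)
    also have "measure (borel_measure \<nu>) (enlargement A \<epsilon>)
        \<le> measure (borel_measure \<nu>) (enlargement A (1 / Suc n))"
      using \<epsilon>(2) by (intro N.finite_measure_mono enlargement_mono) (auto intro!: borel_open open_enlargement)
    finally show ?thesis using \<epsilon>(2) by linarith
  qed
  moreover have "(\<lambda>n. measure (borel_measure \<nu>) (enlargement A (1 / Suc n)) + 1 / Suc n)
      \<longlonglongrightarrow> measure (borel_measure \<nu>) A + 0"
    by (intro tendsto_add enlargement_tendsto assms LIMSEQ_Suc[OF lim_1_over_n])
  ultimately show ?thesis
    by (intro LIMSEQ_le_const[where X = "\<lambda>n. _ n"]) auto
qed

lemma prohorov_eq_0_iff:
  "prohorov (borel_measure \<mu>) (borel_measure \<nu>) = 0 \<longleftrightarrow> \<mu> = \<nu>"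
proof
  interpret M: prob_space "borel_measure \<mu>" by (rule prob_space_borel_measure)
  interpret N: prob_space "borel_measure \<nu>" by (rule prob_space_borel_measure)
  assume eq: "prohorov (borel_measure \<mu>) (borel_measure \<nu>) = 0"
  have "borel_measure \<mu> = borel_measure \<nu>"
  proof (rule measure_eqI_generator_eq)
    show "Int_stable (Collect closed :: 'a set set)"
      by (auto simp: Int_stable_def)
    show "emeasure (borel_measure \<mu>) A = emeasure (borel_measure \<nu>) A"
      if "A \<in> Collect closed" for A
    proof -
      have "measure (borel_measure \<mu>) A = measure (borel_measure \<nu>) A"
        using that eq prohorov_eq_0_closed[of \<mu> \<nu> A] prohorov_eq_0_closed[of \<nu> \<mu> A]
        by (simp add: prohorov_commute)
      then show ?thesis
        by (simp add: M.emeasure_eq_measure N.emeasure_eq_measure)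
    qed
    show "sets (borel_measure \<mu>) = sigma_sets UNIV (Collect closed)"
      and "sets (borel_measure \<nu>) = sigma_sets UNIV (Collect closed)"
      by (simp_all add: borel_eq_closed)
    show "range (\<lambda>_. UNIV :: 'a set) \<subseteq> Collect closed" by auto
  qed auto
  then show "\<mu> = \<nu>" by (simp add: borel_measure_inject)
next
  interpret N: prob_space "borel_measure \<nu>" by (rule prob_space_borel_measure)
  assume "\<mu> = \<nu>"
  have adm: "prohorov_admissible (borel_measure \<nu>) (borel_measure \<nu>) e" if "0 < e" for e
  proof -
    have "measure (borel_measure \<nu>) A \<le> measure (borel_measure \<nu>) (enlargement A e)" for A
      using that by (intro N.finite_measure_mono subset_enlargement) (auto intro!: borel_open open_enlargement)
    with that show ?thesis
      unfolding prohorov_admissible_def by (smt (verit))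
  qed
  have "prohorov (borel_measure \<nu>) (borel_measure \<nu>) \<le> 0"
    by (rule field_le_epsilon) (use prohorov_le[OF adm] in auto)
  moreover have "0 \<le> prohorov (borel_measure \<nu>) (borel_measure \<nu>)"
    unfolding prohorov_def using prohorov_admissible_1[of \<nu> \<nu>]
    by (intro cInf_greatest) (blast, simp add: prohorov_admissible_def)
  ultimately show "prohorov (borel_measure \<mu>) (borel_measure \<nu>) = 0"
    using \<open>\<mu> = \<nu>\<close> by simp
qed

instantiation borel_prob :: (metric_space) metric_space
begin

definition dist_borel_prob :: "'a borel_prob \<Rightarrow> 'a borel_prob \<Rightarrow> real" where
  "dist_borel_prob \<mu> \<nu> = prohorov (borel_measure \<mu>) (borel_measure \<nu>)"

definition uniformity_borel_prob :: "('a borel_prob \<times> 'a borel_prob) filter" where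
  "uniformity_borel_prob = (INF e\<in>{0<..}. principal {(\<mu>, \<nu>). dist \<mu> \<nu> < e})"

definition open_borel_prob :: "'a borel_prob set \<Rightarrow> bool" where
  "open_borel_prob U \<longleftrightarrow> (\<forall>\<mu>\<in>U. \<forall>\<^sub>F (\<mu>', \<nu>) in uniformity. \<mu>' = \<mu> \<longrightarrow> \<nu> \<in> U)"

instance
proof
  fix \<mu> \<nu> \<rho> :: "'a borel_prob"
  show "dist \<mu> \<nu> = 0 \<longleftrightarrow> \<mu> = \<nu>"
    by (simp add: dist_borel_prob_def prohorov_eq_0_iff)
  show "dist \<mu> \<nu> \<le> dist \<mu> \<rho> + dist \<nu> \<rho>"
    unfolding dist_borel_prob_def
    using prohorov_triangle[of \<mu> \<nu> \<rho>] by (simp add: prohorov_commute)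
qed (simp_all add: uniformity_borel_prob_def open_borel_prob_def)

end

definition tight_family :: "'a::metric_space borel_prob set \<Rightarrow> bool" where
  "tight_family F \<longleftrightarrow>
     (\<forall>\<epsilon>>0. \<exists>K. compact K \<and> (\<forall>\<mu>\<in>F. measure (borel_measure \<mu>) K > 1 - \<epsilon>))"

end

theory Submission
  imports Defs
begin

text \<open>
  Compact closure implies tightness by Ulam's argument: finitely many measures, hence a totally
  bounded family of measures, give mass close to one to a finite union of balls of a given small
  radius, and intersecting such unions over radii \<open>(1/2)^k\<close> yields a compact set.

  For the converse, enumerate the balls of radius \<open>(1/2)^k\<close> around a dense sequence and code a
  point by the set of balls containing it.  Along a diagonal subsequence the law of every finite
  part of the code converges; the limits are the finite-dimensional laws of a random code \<open>C\<close>
  defined on the unit interval.  Tightness ensures that \<open>C\<close> almost surely contains a ball of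
  every radius, so it determines a random point \<open>X\<close> by completeness, and the law of \<open>X\<close> is the
  Prohorov limit: a point whose code agrees with \<open>C\<close> on the relevant finite part is near \<open>X\<close>.
\<close>

subsection \<open>Random subsets of the natural numbers\<close>

text \<open>
  Think of \<open>p J T\<close> as the probability that a random set of natural numbers meets \<open>{..<J}\<close>
  exactly in \<open>T\<close>.  The event is realised by the subinterval of \<open>{0..<1}\<close> of length \<open>p J T\<close>
  starting at \<open>left_endpoint p J T\<close>; each interval is cut in two at the next stage, the left
  part standing for \<open>J\<close> not being in the random set.  The set \<open>branch p u J\<close> labels the
  interval of stage \<open>J\<close> that contains \<open>u\<close>.
\<close>

primrec left_endpoint :: "(nat \<Rightarrow> nat set \<Rightarrow> real) \<Rightarrow> nat \<Rightarrow> nat set \<Rightarrow> real" where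
  "left_endpoint p 0 T = 0"
| "left_endpoint p (Suc J) T = left_endpoint p J (T \<inter> {..<J})
     + (if J \<in> T then p (Suc J) (T \<inter> {..<J}) else 0)"

primrec branch :: "(nat \<Rightarrow> nat set \<Rightarrow> real) \<Rightarrow> real \<Rightarrow> nat \<Rightarrow> nat set" where
  "branch p u 0 = {}"
| "branch p u (Suc J) =
    (if left_endpoint p J (branch p u J) + p (Suc J) (branch p u J) \<le> u
     then insert J (branch p u J) else branch p u J)"

lemma branch_subset: "branch p u J \<subseteq> {..<J}"
  by (induction J) (auto simp: less_Suc_eq)

lemma branch_restrict: "J \<le> K \<Longrightarrow> branch p u K \<inter> {..<J} = branch p u J"
proof (induction K rule: dec_induct)
  case base
  show ?case using branch_subset[of p u J] by blast
next
  case (step K)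
  then show ?case by auto
qed

text \<open>The step from stage \<open>J\<close> to the next only decides membership of
  \<open>J\<close>, so the branches are nested. Their union is one set with all the prescribed
  truncations, which lets it serve as the random code.\<close>

lemma Union_branch_restrict: "(\<Union>K. branch p u K) \<inter> {..<J} = branch p u J"
proof (intro antisym subsetI)
  fix j assume j: "j \<in> (\<Union>K. branch p u K) \<inter> {..<J}"
  then obtain K where "j \<in> branch p u K" by auto
  then have "j \<in> branch p u (max J K)"
    using branch_restrict[of K "max J K" p u] by auto
  with j show "j \<in> branch p u J"
    using branch_restrict[of J "max J K" p u] by auto
next
  fix j assume "j \<in> branch p u J"
  then show "j \<in> (\<Union>K. branch p u K) \<inter> {..<J}" using branch_subset[of p u J] by auto
qed

lemma sets_branch_eq: "{u. branch p u J = T} \<in> sets borel"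
proof (induction J arbitrary: T)
  case 0
  then show ?case by auto
next
  case (Suc J)
  let ?c = "\<lambda>T. left_endpoint p J T + p (Suc J) T"
  have "{u. branch p u (Suc J) = T} =
    (if J \<in> T then {u. branch p u J = T - {J}} \<inter> {?c (T - {J})..}
     else {u. branch p u J = T} \<inter> {..<?c T})"
  proof -
    have J: "J \<notin> branch p u J" for u using branch_subset[of p u J] by auto
    show ?thesis
    proof (intro set_eqI)
      fix u
      show "u \<in> {u. branch p u (Suc J) = T} \<longleftrightarrow> u \<in> (if J \<in> T then {u. branch p u J = T - {J}} \<inter> {?c (T - {J})..}
        else {u. branch p u J = T} \<inter> {..<?c T})"
      proof (cases "J \<in> T")
        case True
        then have "insert J (branch p u J) = T \<longleftrightarrow> branch p u J = T - {J}" "branch p u J \<noteq> T"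
          using J[of u] by blast+
        with True show ?thesis
          by (cases "branch p u J = T - {J}") simp_all
      next
        case False
        then have "insert J (branch p u J) \<noteq> T" by blast
        with False show ?thesis
          by (cases "branch p u J = T") simp_all
      qed
    qed
  qed
  also have "\<dots> \<in> sets borel"
    using Suc by auto
  finally show ?case .
qed

text \<open>By \<open>p_split\<close>, the threshold tested in \<open>branch\<close> cuts the
  interval of \<open>T'\<close> into pieces of lengths \<open>p (Suc J) T'\<close> and
  \<open>p (Suc J) (insert J T')\<close>; \<open>p_empty\<close> makes the interval of stage zero
  the unit interval.\<close>

lemma branch_eq_iff:
  assumes p_empty: "p 0 {} = 1" and p_nonneg: "\<And>J T. 0 \<le> p J T"
    and p_split: "\<And>J T. T \<subseteq> {..<J} \<Longrightarrow> p J T = p (Suc J) T + p (Suc J) (insert J T)"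
    and "0 \<le> u" "u < 1" "T \<subseteq> {..<J}"
  shows "branch p u J = T \<longleftrightarrow> left_endpoint p J T \<le> u \<and> u < left_endpoint p J T + p J T"
  using \<open>T \<subseteq> {..<J}\<close>
proof (induction J arbitrary: T)
  case 0
  then show ?case using p_empty \<open>0 \<le> u\<close> \<open>u < 1\<close> by auto
next
  case (Suc J)
  define T' where "T' = T \<inter> {..<J}"
  have T': "T' \<subseteq> {..<J}" "J \<notin> T'" by (auto simp: T'_def)
  have T: "T = (if J \<in> T then insert J T' else T')"
    using Suc.prems by (auto simp: T'_def less_Suc_eq)
  have J: "J \<notin> branch p u J" using branch_subset[of p u J] by auto
  note IH = Suc.IH[OF T'(1)] and split = p_split[OF T'(1)]
  show ?case
  proof (cases "J \<in> T")
    case True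
    then have T: "T = insert J T'" using T by simp
    have "branch p u (Suc J) = T \<longleftrightarrow>
        branch p u J = T' \<and> left_endpoint p J T' + p (Suc J) T' \<le> u"
      using J T'(2) unfolding T by (auto simp: insert_ident)
    moreover have "left_endpoint p (Suc J) T = left_endpoint p J T' + p (Suc J) T'"
      using True by (simp add: T'_def)
    ultimately show ?thesis
      using IH split p_nonneg[of "Suc J" T'] unfolding T by auto
  next
    case False
    then have T: "T = T'" using T by simp
    have "branch p u (Suc J) = T \<longleftrightarrow>
        branch p u J = T' \<and> u < left_endpoint p J T' + p (Suc J) T'"
      using J T'(2) unfolding T by auto
    moreover have "left_endpoint p (Suc J) T = left_endpoint p J T'"
      using False by (simp add: T'_def)
    ultimately show ?thesis
      using IH split p_nonneg[of "Suc J" "insert J T'"] unfolding T by auto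
  qed
qed

text \<open>Each interval lies inside that of its parent \<open>T'\<close>. Hence restricting the
  uniform measure to the unit interval cuts nothing off, and lengths are probabilities.\<close>

lemma interval_subset_unit:
  assumes p_empty: "p 0 {} = 1" and p_nonneg: "\<And>J T. 0 \<le> p J T"
    and p_split: "\<And>J T. T \<subseteq> {..<J} \<Longrightarrow> p J T = p (Suc J) T + p (Suc J) (insert J T)"
    and "T \<subseteq> {..<J}"
  shows "0 \<le> left_endpoint p J T \<and> left_endpoint p J T + p J T \<le> 1"
  using \<open>T \<subseteq> {..<J}\<close>
proof (induction J arbitrary: T)
  case 0
  then show ?case using p_empty by auto
next
  case (Suc J)
  define T' where "T' = T \<inter> {..<J}"
  have T': "T' \<subseteq> {..<J}" by (auto simp: T'_def)
  have T: "T = (if J \<in> T then insert J T' else T')"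
    using Suc.prems by (auto simp: T'_def less_Suc_eq)
  have "left_endpoint p (Suc J) T = left_endpoint p J T' + (if J \<in> T then p (Suc J) T' else 0)"
    by (simp add: T'_def)
  then show ?case
    using T Suc.IH[OF T'] p_split[OF T'] p_nonneg[of "Suc J" T'] p_nonneg[of "Suc J" "insert J T'"]
    by (auto split: if_splits)
qed

abbreviation unit_uniform :: "real measure" where
  "unit_uniform \<equiv> uniform_measure lborel {0..<1}"

lemma prob_space_unit_uniform: "prob_space unit_uniform"
  by (rule prob_space_uniform_measure) auto

lemma measure_branch_eq:
  assumes p_empty: "p 0 {} = 1" and p_nonneg: "\<And>J T. 0 \<le> p J T"
    and p_split: "\<And>J T. T \<subseteq> {..<J} \<Longrightarrow> p J T = p (Suc J) T + p (Suc J) (insert J T)"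
    and T: "T \<subseteq> {..<J}"
  shows "measure unit_uniform {u. branch p u J = T} = p J T"
proof -
  let ?a = "left_endpoint p J T"
  have "{0..<1} \<inter> {u. branch p u J = T} = {?a..<?a + p J T}"
  proof (intro set_eqI)
    fix u
    show "u \<in> {0..<1} \<inter> {u. branch p u J = T} \<longleftrightarrow> u \<in> {?a..<?a + p J T}"
      using branch_eq_iff[of p u T J, OF p_empty p_nonneg p_split _ _ T]
        interval_subset_unit[of p T J, OF p_empty p_nonneg p_split T]
      by (cases "0 \<le> u \<and> u < 1") auto
  qed
  then show ?thesis
    using sets_branch_eq[of p J T] p_nonneg[of J T] by simp
qed

section \<open>Truncated codes and the convergence of their laws\<close>

text \<open>A truncation takes only finitely many values, so an arbitrary \<open>S\<close> may be
  replaced by the finite set \<open>S \<inter> Pow {..<J}\<close>, and its probability is a finite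
  sum over atoms.\<close>

lemma
  fixes C :: "'a \<Rightarrow> nat set"
  assumes "\<And>j. {x \<in> space M. j \<in> C x} \<in> sets M"
  shows sets_truncation: "{x \<in> space M. C x \<inter> {..<J} \<in> S} \<in> sets M"
    and measure_truncation: "finite_measure M \<Longrightarrow> measure M {x \<in> space M. C x \<inter> {..<J} \<in> S}
      = (\<Sum>T\<in>S \<inter> Pow {..<J}. measure M {x \<in> space M. C x \<inter> {..<J} = T})"
proof -
  have *: "{x \<in> space M. C x \<inter> {..<J} \<in> S}
      = (\<Union>T\<in>S \<inter> Pow {..<J}. {x \<in> space M. C x \<inter> {..<J} = T})"
    by auto
  have [measurable]: "Measurable.pred M (\<lambda>x. j \<in> C x)" for j
    using assms by (simp add: pred_def)
  have **: "{x \<in> space M. C x \<inter> {..<J} = T} \<in> sets M" if "T \<subseteq> {..<J}" for T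
  proof -
    have "{x \<in> space M. C x \<inter> {..<J} = T} = {x \<in> space M. \<forall>j\<in>{..<J}. j \<in> C x \<longleftrightarrow> j \<in> T}"
      using that by auto
    also have "\<dots> \<in> sets M"
      by (intro sets.sets_Collect_finite_All predE pred_intros_logic) (auto simp: assms)
    finally show ?thesis .
  qed
  show "{x \<in> space M. C x \<inter> {..<J} \<in> S} \<in> sets M"
    unfolding * using ** by (intro sets.finite_UN) auto
  assume "finite_measure M"
  then interpret finite_measure M .
  show "measure M {x \<in> space M. C x \<inter> {..<J} \<in> S}
      = (\<Sum>T\<in>S \<inter> Pow {..<J}. measure M {x \<in> space M. C x \<inter> {..<J} = T})"
    unfolding * using **
    by (intro finite_measure_finite_Union) (auto simp: disjoint_family_on_def)
qed

text \<open>Tychonoff's theorem replaces the explicit diagonal argument: the cube is compact, and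
  over a countable index type the function space is a metric space, where compactness yields
  convergent subsequences.\<close>

lemma diagonal_subsequence:
  fixes f :: "nat \<Rightarrow> 'i::countable \<Rightarrow> real"
  assumes "\<And>n i. f n i \<in> {0..1}"
  obtains r l where "strict_mono r" "\<And>i. (\<lambda>n. f (r n) i) \<longlonglongrightarrow> l i"
proof -
  have "compactin (product_topology (\<lambda>_. euclidean) UNIV) (PiE UNIV (\<lambda>_::'i. {0..1::real}))"
    by (simp add: compactin_PiE)
  then have "compact (PiE UNIV (\<lambda>_::'i. {0..1::real}))"
    by (simp add: euclidean_product_topology flip: compactin_euclidean_iff)
  moreover have "f n \<in> PiE UNIV (\<lambda>_::'i. {0..1::real})" for n
    using assms by auto
  ultimately obtain l r where r: "strict_mono r" "(f \<circ> r) \<longlonglongrightarrow> l"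
    unfolding compact_def by metis
  have "(\<lambda>n. f (r n) i) \<longlonglongrightarrow> l i" for i
    using continuous_on_tendsto_compose[OF continuous_on_product_coordinates r(2), of i]
    by (simp add: comp_def)
  with r(1) show thesis by (rule that)
qed

text \<open>
  Uniformity in \<open>S\<close> is what later makes the Prohorov inequality hold for all closed sets at once.
\<close>

lemma limit_random_code:
  fixes \<mu> :: "nat \<Rightarrow> 'a::topological_space measure" and A :: "nat \<Rightarrow> 'a set"
  assumes \<mu>: "\<And>n. prob_space (\<mu> n)" "\<And>n. sets (\<mu> n) = sets borel"
    and A: "\<And>j. A j \<in> sets borel"
  obtains r C where "strict_mono r" "\<And>j. {u. j \<in> C u} \<in> sets borel"
    "\<And>J e. 0 < e \<Longrightarrow> \<forall>\<^sub>F n in sequentially. \<forall>S.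
        \<bar>measure (\<mu> (r n)) {x. {j. x \<in> A j} \<inter> {..<J} \<in> S}
          - measure unit_uniform {u. C u \<inter> {..<J} \<in> S}\<bar> < e"
proof -
  interpret \<mu>: prob_space "\<mu> n" for n by (rule \<mu>)
  interpret U: prob_space unit_uniform by (rule prob_space_unit_uniform)
  have space: "space (\<mu> n) = UNIV" for n
    using sets_eq_imp_space_eq[OF \<mu>(2)] by simp
  let ?c = "\<lambda>x. {j. x \<in> A j}"
  define q where "q n J T = measure (\<mu> n) {x. ?c x \<inter> {..<J} = T}" for n J T
  have c: "{x \<in> space (\<mu> n). j \<in> ?c x} \<in> sets (\<mu> n)" for n j
    using A \<mu>(2) space by simp
  have sets_c: "{x. ?c x \<inter> {..<J} \<in> S} \<in> sets (\<mu> n)" for J S n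
    using sets_truncation[OF c] by (simp add: space)
  \<comment> \<open>Finite sets of naturals are coded as naturals to make the index type
    countable.\<close>
  obtain r l where r: "strict_mono r"
    and l: "\<And>i. (\<lambda>n. q (r n) (fst i) (set_decode (snd i))) \<longlonglongrightarrow> l i"
    by (rule diagonal_subsequence[of "\<lambda>n i. q n (fst i) (set_decode (snd i))"]) (auto simp: q_def)
  define p where "p J T = l (J, set_encode T)" for J T
  have lim: "(\<lambda>n. q (r n) J T) \<longlonglongrightarrow> p J T" if "T \<subseteq> {..<J}" for J T
    using l[of "(J, set_encode T)"] that by (simp add: p_def finite_subset)
  have p_empty: "p 0 {} = 1"
    using lim[of "{}" 0] \<mu>.prob_space by (simp add: q_def LIMSEQ_const_iff space)
  \<comment> \<open>This includes infinite \<open>T\<close>, where \<open>set_encode\<close> returns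
    a default: every value of \<open>l\<close> is a limit of probabilities.\<close>
  have p_nonneg: "0 \<le> p J T" for J T
    unfolding p_def by (rule LIMSEQ_le_const[OF l]) (auto simp: q_def)
  have p_split: "p J T = p (Suc J) T + p (Suc J) (insert J T)" if T: "T \<subseteq> {..<J}" for J T
  proof -
    \<comment> \<open>For each \<open>n\<close> the event splits by whether \<open>J\<close> is in
      the code; this additivity survives the limit.\<close>
    have q: "q n J T = q n (Suc J) T + q n (Suc J) (insert J T)" for n
    proof -
      have "{x. ?c x \<inter> {..<J} = T} =
          {x. ?c x \<inter> {..<Suc J} = T} \<union> {x. ?c x \<inter> {..<Suc J} = insert J T}"
      proof (intro set_eqI)
        fix x
        have J: "J \<notin> ?c x \<inter> {..<J}" "J \<notin> T" using T by auto
        show "x \<in> {x. ?c x \<inter> {..<J} = T} \<longleftrightarrow>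
            x \<in> {x. ?c x \<inter> {..<Suc J} = T} \<union> {x. ?c x \<inter> {..<Suc J} = insert J T}"
        proof (cases "J \<in> ?c x")
          case True
          then have "?c x \<inter> {..<Suc J} = insert J (?c x \<inter> {..<J})" by auto
          then show ?thesis using insert_ident[OF J] True J(2) by blast
        next
          case False
          then have "?c x \<inter> {..<Suc J} = ?c x \<inter> {..<J}" by (auto simp: less_Suc_eq)
          then show ?thesis using False by blast
        qed
      qed
      moreover have "{x. ?c x \<inter> {..<Suc J} = T} \<inter> {x. ?c x \<inter> {..<Suc J} = insert J T} = {}"
        using T by auto
      ultimately show ?thesis
        unfolding q_def using sets_c[of "Suc J" "{_}"] by (simp add: \<mu>.finite_measure_Union)
    qed
    have "(\<lambda>n. q (r n) J T) \<longlonglongrightarrow> p (Suc J) T + p (Suc J) (insert J T)"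
      unfolding q using T by (intro tendsto_add lim) auto
    then show ?thesis
      using lim[OF T] LIMSEQ_unique by blast
  qed
  define C where "C u = (\<Union>K. branch p u K)" for u
  have C: "C u \<inter> {..<J} = branch p u J" for u J
    unfolding C_def by (rule Union_branch_restrict)
  have meas_C: "{u. j \<in> C u} \<in> sets borel" for j
  proof -
    have "{u. j \<in> C u} = (\<Union>T\<in>{T. j \<in> T \<and> T \<subseteq> {..<Suc j}}. {u. branch p u (Suc j) = T})"
      using C[of _ "Suc j"] branch_subset[of p _ "Suc j"] by blast
    also have "\<dots> \<in> sets borel"
      by (intro sets.finite_UN sets_branch_eq) auto
    finally show ?thesis .
  qed
  have conv: "(\<lambda>n. measure (\<mu> (r n)) {x. ?c x \<inter> {..<J} \<in> S})
      \<longlonglongrightarrow> measure unit_uniform {u. C u \<inter> {..<J} \<in> S}" for J S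
  proof -
    have "measure (\<mu> n) {x. ?c x \<inter> {..<J} \<in> S} = (\<Sum>T\<in>S \<inter> Pow {..<J}. q n J T)" for n
      using measure_truncation[OF c, of n J S] by (simp add: space q_def \<mu>.finite_measure_axioms)
    moreover have "measure unit_uniform {u. C u \<inter> {..<J} \<in> S} = (\<Sum>T\<in>S \<inter> Pow {..<J}. p J T)"
      using measure_truncation[of unit_uniform C J S] meas_C
        measure_branch_eq[of p, OF p_empty p_nonneg p_split]
      by (simp add: C U.finite_measure_axioms)
    ultimately show ?thesis
      by (auto intro!: tendsto_sum lim)
  qed
  have "\<forall>\<^sub>F n in sequentially. \<forall>S.
        \<bar>measure (\<mu> (r n)) {x. ?c x \<inter> {..<J} \<in> S} - measure unit_uniform {u. C u \<inter> {..<J} \<in> S}\<bar> < e"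
    if "0 < e" for J e
  proof -
    \<comment> \<open>There are only finitely many such \<open>S\<close>, so pointwise convergence
      is already uniform over them.\<close>
    have "\<forall>\<^sub>F n in sequentially. \<forall>S\<in>Pow (Pow {..<J}).
        \<bar>measure (\<mu> (r n)) {x. ?c x \<inter> {..<J} \<in> S} - measure unit_uniform {u. C u \<inter> {..<J} \<in> S}\<bar> < e"
      using conv[of J, THEN tendstoD, OF \<open>0 < e\<close>]
      by (intro eventually_ball_finite) (auto simp: dist_real_def)
    then show ?thesis
    proof eventually_elim
      case (elim n)
      show ?case
      proof
        fix S :: "nat set set"
        have "D \<inter> {..<J} \<in> S \<inter> Pow {..<J} \<longleftrightarrow> D \<inter> {..<J} \<in> S" for D by auto
        then show "\<bar>measure (\<mu> (r n)) {x. ?c x \<inter> {..<J} \<in> S}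
            - measure unit_uniform {u. C u \<inter> {..<J} \<in> S}\<bar> < e"
          using elim[rule_format, of "S \<inter> Pow {..<J}"] by simp
      qed
    qed
  qed
  with r meas_C show thesis by (rule that)
qed

subsection \<open>Prohorov convergence of a tight sequence\<close>

text \<open>One of the two inequalities suffices: apply it to the complement of the open enlargement
  of \<open>A\<close>, whose own enlargement misses \<open>A\<close>, and pass to
  complements.\<close>

lemma prohorov_admissibleI:
  fixes \<mu> \<nu> :: "'a::metric_space borel_prob"
  assumes "0 < e"
    and le: "\<And>A. closed A \<Longrightarrow> measure (borel_measure \<mu>) A \<le> measure (borel_measure \<nu>) (enlargement A e) + e"
  shows "prohorov_admissible (borel_measure \<mu>) (borel_measure \<nu>) e"
proof -
  interpret M: prob_space "borel_measure \<mu>" by (rule prob_space_borel_measure)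
  interpret N: prob_space "borel_measure \<nu>" by (rule prob_space_borel_measure)
  have "measure (borel_measure \<nu>) A \<le> measure (borel_measure \<mu>) (enlargement A e) + e" if "closed A" for A
  proof -
    let ?B = "- enlargement A e"
    have "closed ?B" using open_enlargement by (simp add: closed_def)
    then have "measure (borel_measure \<mu>) ?B \<le> measure (borel_measure \<nu>) (enlargement ?B e) + e"
      by (rule le)
    also have "measure (borel_measure \<nu>) (enlargement ?B e) \<le> measure (borel_measure \<nu>) (- A)"
    proof (rule N.finite_measure_mono)
      show "enlargement ?B e \<subseteq> - A"
      proof
        fix x assume "x \<in> enlargement ?B e"
        then obtain y where "y \<notin> enlargement A e" "dist y x < e"
          by (auto simp: enlargement_def dist_commute)
        then show "x \<in> - A" by (auto simp: enlargement_def)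
      qed
      show "- A \<in> sets (borel_measure \<nu>)"
        using that by (simp add: borel_open open_Compl)
    qed
    finally show ?thesis
      using M.prob_compl[of "enlargement A e"] N.prob_compl[of A] that
      by (simp add: Compl_eq_Diff_UNIV open_enlargement)
  qed
  with assms show ?thesis by (auto simp: prohorov_admissible_def)
qed

lemma dist_borel_prob_le:
  "prohorov_admissible (borel_measure \<mu>) (borel_measure \<nu>) e \<Longrightarrow> dist \<mu> \<nu> \<le> e"
  by (simp add: dist_borel_prob_def prohorov_le)

text \<open>A sequence in the closure is replaced by one in \<open>F\<close> whose distance to it
  tends to zero; along a common subsequence both have the same limit.\<close>

lemma compact_closure_sequentiallyI:
  fixes F :: "'a::metric_space set"
  assumes "\<And>f. range f \<subseteq> F \<Longrightarrow> \<exists>r l. strict_mono (r :: nat \<Rightarrow> nat) \<and> (\<lambda>n. f (r n)) \<longlonglongrightarrow> l"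
  shows "compact (closure F)"
  unfolding compact_def
proof (intro allI impI)
  fix f :: "nat \<Rightarrow> 'a" assume f: "\<forall>n. f n \<in> closure F"
  have "\<forall>n. \<exists>y\<in>F. dist y (f n) < inverse (real (Suc n))"
    using f by (auto simp: closure_approachable)
  then obtain g where g: "\<And>n. g n \<in> F" "\<And>n. dist (g n) (f n) < inverse (real (Suc n))"
    by metis
  from g(1) have "range g \<subseteq> F" by auto
  from assms[OF this] obtain r :: "nat \<Rightarrow> nat" and l
    where r: "strict_mono r" "(\<lambda>n. g (r n)) \<longlonglongrightarrow> l"
    by auto
  have "(\<lambda>n. f (r n)) \<longlonglongrightarrow> l"
  proof (subst tendsto_dist_iff, rule tendsto_sandwich[OF _ _ tendsto_const])
    show "(\<lambda>n. inverse (real (Suc n)) + dist (g (r n)) l) \<longlonglongrightarrow> 0"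
      using tendsto_add[OF LIMSEQ_inverse_real_of_nat tendsto_dist[OF r(2) tendsto_const[of l]]] by simp
    have "dist (f (r n)) l \<le> inverse (real (Suc n)) + dist (g (r n)) l" for n
    proof -
      have "inverse (real (Suc (r n))) \<le> inverse (real (Suc n))"
        using seq_suble[OF r(1), of n] by (simp add: le_imp_inverse_le)
      with g(2)[of "r n"] show ?thesis
        using dist_triangle3[of "f (r n)" l "g (r n)"] by linarith
    qed
    then show "\<forall>\<^sub>F n in sequentially. dist (f (r n)) l \<le> inverse (real (Suc n)) + dist (g (r n)) l"
      by (rule always_eventually[OF allI])
  qed simp
  then have "(f \<circ> r) \<longlonglongrightarrow> l" by (simp add: comp_def)
  moreover from this have "l \<in> closure F"
    using f by (intro Lim_in_closed_set[of "closure F" "f \<circ> r"]) auto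
  ultimately show "\<exists>l\<in>closure F. \<exists>r. strict_mono r \<and> (f \<circ> r) \<longlonglongrightarrow> l"
    using r(1) by blast
qed

lemma dense_sequence:
  obtains x :: "nat \<Rightarrow> 'a::{metric_space, second_countable_topology}"
  where "\<And>y e. 0 < e \<Longrightarrow> \<exists>i. y \<in> ball (x i) e"
proof -
  obtain D :: "'a set" where D: "countable D" "\<And>X. open X \<Longrightarrow> X \<noteq> {} \<Longrightarrow> \<exists>d\<in>D. d \<in> X"
    using countable_dense_setE by blast
  then have "D \<noteq> {}" using D(2)[of UNIV] by auto
  show thesis
  proof (rule that[of "from_nat_into D"])
    fix y :: 'a and e :: real assume "0 < e"
    then obtain d where "d \<in> D" "d \<in> ball y e" using D(2)[of "ball y e"] by auto
    then show "\<exists>i. y \<in> ball (from_nat_into D i) e"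
      using from_nat_into_surj[OF D(1), of d] by (auto simp: dist_commute)
  qed
qed

text \<open>A pair \<open>(k, i)\<close> names the ball of radius \<open>(1/2)^k\<close> around
  \<open>x i\<close>, and \<open>coherent\<close> is what a common point of two balls gives. It
  makes the centres \<open>x (a m)\<close> a Cauchy sequence; letting \<open>m\<close> grow in
  \<open>coherent\<close> yields the bound on \<open>z\<close>.\<close>

lemma coherent_balls_converge:
  fixes x :: "nat \<Rightarrow> 'a::complete_space"
  assumes coherent: "\<And>k i m j. (k, i) \<in> D \<Longrightarrow> (m, j) \<in> D \<Longrightarrow> dist (x i) (x j) < (1/2)^k + (1/2)^m"
    and a: "\<And>m. (m, a m) \<in> D"
  obtains z where "(\<lambda>m. x (a m)) \<longlonglongrightarrow> z" "\<And>k i. (k, i) \<in> D \<Longrightarrow> dist z (x i) \<le> (1/2)^k"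
proof -
  have "Cauchy (\<lambda>m. x (a m))"
  proof (rule metric_CauchyI)
    fix e :: real assume "0 < e"
    then obtain M where M: "(1/2::real)^M < e / 2"
      using real_arch_pow_inv[of "e/2" "1/2"] by auto
    have "dist (x (a m)) (x (a n)) < e" if "M \<le> m" "M \<le> n" for m n
    proof -
      have "(1/2::real)^m \<le> (1/2)^M" "(1/2::real)^n \<le> (1/2)^M"
        using that by (auto intro: power_decreasing)
      with M coherent[OF a[of m] a[of n]] show ?thesis by linarith
    qed
    then show "\<exists>M. \<forall>m\<ge>M. \<forall>n\<ge>M. dist (x (a m)) (x (a n)) < e" by blast
  qed
  then obtain z where z: "(\<lambda>m. x (a m)) \<longlonglongrightarrow> z"
    using Cauchy_convergent convergent_def by blast
  have "dist z (x i) \<le> (1/2)^k" if "(k, i) \<in> D" for k i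
  proof (rule LIMSEQ_le)
    show "(\<lambda>m. dist (x (a m)) (x i)) \<longlonglongrightarrow> dist z (x i)"
      by (intro tendsto_dist z tendsto_const)
    have "(\<lambda>m. (1/2::real)^m + (1/2)^k) \<longlonglongrightarrow> 0 + (1/2)^k"
      by (intro tendsto_add LIMSEQ_power_zero tendsto_const) simp
    then show "(\<lambda>m. (1/2::real)^m + (1/2)^k) \<longlonglongrightarrow> (1/2)^k" by simp
    show "\<exists>N. \<forall>m\<ge>N. dist (x (a m)) (x i) \<le> (1/2)^m + (1/2)^k"
      using coherent[OF a that] less_imp_le by blast
  qed
  with z show thesis by (rule that)
qed

lemma tight_family_imp_convergent_subsequence:
  fixes \<nu> :: "nat \<Rightarrow> 'a::polish_space borel_prob"
  assumes tight: "tight_family (range \<nu>)"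
  obtains r l where "strict_mono r" "(\<lambda>n. \<nu> (r n)) \<longlonglongrightarrow> l"
proof -
  interpret N: prob_space "borel_measure (\<nu> n)" for n by (rule prob_space_borel_measure)
  interpret U: prob_space unit_uniform by (rule prob_space_unit_uniform)
  obtain x :: "nat \<Rightarrow> 'a" where x: "\<And>y e. 0 < e \<Longrightarrow> \<exists>i. y \<in> ball (x i) e"
    using dense_sequence by blast
  define A where "A j = (case prod_decode j of (k, i) \<Rightarrow> ball (x i) ((1/2)^k))" for j
  have A_encode [simp]: "A (prod_encode (k, i)) = ball (x i) ((1/2)^k)" for k i
    by (simp add: A_def)
  have sets_A: "A j \<in> sets borel" for j
    by (auto simp: A_def split: prod.split)
  let ?c = "\<lambda>y. {j. y \<in> A j}"
  obtain r C where r: "strict_mono r" and meas_C: "\<And>j. {u. j \<in> C u} \<in> sets borel"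
    and conv: "\<And>J e. 0 < e \<Longrightarrow> \<forall>\<^sub>F n in sequentially. \<forall>S.
        \<bar>measure (borel_measure (\<nu> (r n))) {y. ?c y \<inter> {..<J} \<in> S}
          - measure unit_uniform {u. C u \<inter> {..<J} \<in> S}\<bar> < e"
    by (rule limit_random_code[of "\<lambda>n. borel_measure (\<nu> n)" A])
      (auto simp: sets_A prob_space_borel_measure)
  have [measurable]: "Measurable.pred borel (\<lambda>u. j \<in> C u)" for j
    using meas_C by (simp add: pred_def)
  have trunc_C: "{u. C u \<inter> {..<J} \<in> S} \<in> sets borel" for J S
    using sets_truncation[of borel C J S] meas_C by simp
  have trunc_c: "{y. ?c y \<inter> {..<J} \<in> S} \<in> sets borel" for J S
    using sets_truncation[of borel ?c J S] sets_A by simp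
  \<comment> \<open>A finite subcover of one compact set serves all measures at once;
    \<open>J\<close> is chosen so that truncation at \<open>J\<close> still sees all
    \<open>N\<close> balls.\<close>
  have cover: "\<exists>N J. (\<forall>i<N. prod_encode (k, i) < J) \<and>
      (\<forall>n. 1 - e < measure (borel_measure (\<nu> n)) (\<Union>i<N. A (prod_encode (k, i))))"
    if "0 < e" for e k
  proof -
    obtain K where K: "compact K" "\<And>n. 1 - e < measure (borel_measure (\<nu> n)) K"
      using tight \<open>0 < e\<close> by (auto simp: tight_family_def)
    have "K \<subseteq> (\<Union>i. A (prod_encode (k, i)))"
      using x[of "(1/2)^k"] by fastforce
    then obtain I where I: "finite I" "K \<subseteq> (\<Union>i\<in>I. A (prod_encode (k, i)))"
      using compactE_image[OF K(1), of UNIV "\<lambda>i. A (prod_encode (k, i))"] by auto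
    obtain N where N: "I \<subseteq> {..<N}"
      using I(1) finite_nat_bounded by blast
    obtain J where J: "(\<lambda>i. prod_encode (k, i)) ` {..<N} \<subseteq> {..<J}"
      using finite_nat_bounded[of "(\<lambda>i. prod_encode (k, i)) ` {..<N}"] by blast
    have "1 - e < measure (borel_measure (\<nu> n)) (\<Union>i<N. A (prod_encode (k, i)))" for n
    proof -
      have "K \<subseteq> (\<Union>i<N. A (prod_encode (k, i)))"
        using I(2) N by blast
      then have "measure (borel_measure (\<nu> n)) K \<le> measure (borel_measure (\<nu> n)) (\<Union>i<N. A (prod_encode (k, i)))"
        using sets_A by (intro N.finite_measure_mono) auto
      with K(2)[of n] show ?thesis by linarith
    qed
    with J show ?thesis by blast
  qed
  \<comment> \<open>For a good code, any finitely many of the coded balls have a common point.\<close>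
  define good where "good D \<longleftrightarrow> (\<forall>J. D \<inter> {..<J} \<in> range (\<lambda>y. ?c y \<inter> {..<J}))
      \<and> (\<forall>k. \<exists>i. prod_encode (k, i) \<in> D)" for D
  have meas_good: "{u. good (C u)} \<in> sets borel"
  proof -
    have "{u. good (C u)} = (\<Inter>J. {u. C u \<inter> {..<J} \<in> range (\<lambda>y. ?c y \<inter> {..<J})})
        \<inter> (\<Inter>k. \<Union>i. {u. prod_encode (k, i) \<in> C u})"
      by (auto simp: good_def)
    also have "\<dots> \<in> sets borel"
      by (intro sets.Int sets.countable_INT'' sets.countable_UN trunc_C) (auto intro: meas_C)
    finally show ?thesis .
  qed
  have realizable: "AE u in unit_uniform. C u \<inter> {..<J} \<in> range (\<lambda>y. ?c y \<inter> {..<J})" for J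
  proof -
    \<comment> \<open>No point has its truncated code in \<open>?S\<close>, so this event is null
      under every \<open>\<nu> (r n)\<close>, and \<open>conv\<close> carries that over to
      \<open>C\<close>.\<close>
    let ?S = "- range (\<lambda>y. ?c y \<inter> {..<J})"
    have "measure unit_uniform {u. C u \<inter> {..<J} \<in> ?S} \<le> 0"
    proof (rule field_le_epsilon)
      fix e :: real assume "0 < e"
      then obtain n where "\<bar>measure (borel_measure (\<nu> (r n))) {y. ?c y \<inter> {..<J} \<in> ?S}
          - measure unit_uniform {u. C u \<inter> {..<J} \<in> ?S}\<bar> < e"
        using conv[of e J] unfolding eventually_sequentially by blast
      then show "measure unit_uniform {u. C u \<inter> {..<J} \<in> ?S} \<le> 0 + e" by simp
    qed
    then have "AE u in unit_uniform. u \<notin> {u. C u \<inter> {..<J} \<in> ?S}"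
      using trunc_C[of J ?S] by (subst U.prob_eq_0[symmetric])
        (simp_all only: measure_le_0_iff sets_uniform_measure sets_lborel)
    then show ?thesis by eventually_elim simp
  qed
  have level: "AE u in unit_uniform. \<exists>i. prod_encode (k, i) \<in> C u" for k
  proof -
    have meas: "{u. \<forall>i. prod_encode (k, i) \<notin> C u} \<in> sets borel" by measurable
    have "measure unit_uniform {u. \<forall>i. prod_encode (k, i) \<notin> C u} \<le> 0"
    proof (rule field_le_epsilon)
      fix e :: real assume "0 < e"
      obtain N J where J: "\<And>i. i < N \<Longrightarrow> prod_encode (k, i) < J"
        and N: "\<And>n. 1 - e / 2 < measure (borel_measure (\<nu> n)) (\<Union>i<N. A (prod_encode (k, i)))"
        using cover[of "e/2" k] \<open>0 < e\<close> by auto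
      \<comment> \<open>A code without any ball of level \<open>k\<close> has its truncation in
        \<open>?S\<close>. For the code of a point, \<open>?S\<close> means lying outside the union
        from \<open>cover\<close>, which has small mass.\<close>
      let ?S = "{T. \<forall>i<N. prod_encode (k, i) \<notin> T}"
      obtain n where n: "\<bar>measure (borel_measure (\<nu> (r n))) {y. ?c y \<inter> {..<J} \<in> ?S}
          - measure unit_uniform {u. C u \<inter> {..<J} \<in> ?S}\<bar> < e / 2"
        using conv[of "e/2" J] \<open>0 < e\<close> unfolding eventually_sequentially by fastforce
      have "{y. ?c y \<inter> {..<J} \<in> ?S} = UNIV - (\<Union>i<N. A (prod_encode (k, i)))"
        using J by auto
      then have "measure (borel_measure (\<nu> (r n))) {y. ?c y \<inter> {..<J} \<in> ?S} \<le> e / 2"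
        using N.prob_compl[of "\<Union>i<N. A (prod_encode (k, i))" "r n"] N[of "r n"] sets_A by auto
      moreover have "measure unit_uniform {u. \<forall>i. prod_encode (k, i) \<notin> C u}
          \<le> measure unit_uniform {u. C u \<inter> {..<J} \<in> ?S}"
        using trunc_C[of J ?S] by (intro U.finite_measure_mono) auto
      ultimately show "measure unit_uniform {u. \<forall>i. prod_encode (k, i) \<notin> C u} \<le> 0 + e"
        using n by linarith
    qed
    then have "AE u in unit_uniform. u \<notin> {u. \<forall>i. prod_encode (k, i) \<notin> C u}"
      using meas by (subst U.prob_eq_0[symmetric])
        (simp_all only: measure_le_0_iff sets_uniform_measure sets_lborel)
    then show ?thesis by eventually_elim auto
  qed
  have AE_good: "AE u in unit_uniform. good (C u)"
    using realizable level unfolding good_def by (simp add: AE_all_countable)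
  have good_limit: "\<exists>z. (\<lambda>m. x (LEAST i. prod_encode (m, i) \<in> D)) \<longlonglongrightarrow> z \<and>
      (\<forall>k i. prod_encode (k, i) \<in> D \<longrightarrow> dist z (x i) \<le> (1/2)^k)" if "good D" for D
  proof -
    have "dist (x i) (x j) < (1/2)^k + (1/2)^m"
      if D: "prod_encode (k, i) \<in> D" "prod_encode (m, j) \<in> D" for k i m j
    proof -
      \<comment> \<open>Truncating just past both indices keeps them, so the point \<open>y\<close>
        realizing this truncation lies in both balls.\<close>
      let ?J = "Suc (max (prod_encode (k, i)) (prod_encode (m, j)))"
      obtain y where y: "D \<inter> {..<?J} = ?c y \<inter> {..<?J}"
        using \<open>good D\<close> unfolding good_def by blast
      have "prod_encode (k, i) \<in> ?c y \<inter> {..<?J}" "prod_encode (m, j) \<in> ?c y \<inter> {..<?J}"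
        unfolding y[symmetric] using D by auto
      then have "dist (x i) y < (1/2)^k" "dist (x j) y < (1/2)^m" by auto
      then show ?thesis using dist_triangle2[of "x i" "x j" y] by linarith
    qed
    moreover have "prod_encode (m, LEAST i. prod_encode (m, i) \<in> D) \<in> D" for m
      using \<open>good D\<close> unfolding good_def by (meson LeastI_ex)
    ultimately obtain z where "(\<lambda>m. x (LEAST i. prod_encode (m, i) \<in> D)) \<longlonglongrightarrow> z"
      "\<And>k i. (k, i) \<in> {(k, i). prod_encode (k, i) \<in> D} \<Longrightarrow> dist z (x i) \<le> (1/2)^k"
      using coherent_balls_converge[of "{(k, i). prod_encode (k, i) \<in> D}" x "\<lambda>m. LEAST i. prod_encode (m, i) \<in> D"]
      by simp metis
    then show ?thesis by auto
  qed
  \<comment> \<open>Measurable approximations of \<open>X\<close>: the first listed centre at each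
    level. The constant default makes them converge for every \<open>u\<close>, so that the limit is
    measurable.\<close>
  define Y where "Y m u = (if good (C u) then x (LEAST i. prod_encode (m, i) \<in> C u) else x 0)" for m u
  have "\<exists>z. (\<lambda>m. Y m u) \<longlonglongrightarrow> z \<and>
      (good (C u) \<longrightarrow> (\<forall>k i. prod_encode (k, i) \<in> C u \<longrightarrow> dist z (x i) \<le> (1/2)^k))" for u
    using good_limit[of "C u"] by (cases "good (C u)") (auto simp: Y_def)
  then obtain X where X: "\<And>u. (\<lambda>m. Y m u) \<longlonglongrightarrow> X u"
    "\<And>u k i. good (C u) \<Longrightarrow> prod_encode (k, i) \<in> C u \<Longrightarrow> dist (X u) (x i) \<le> (1/2)^k"
    by metis
  have meas_Y: "Y m \<in> borel_measurable borel" for m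
  proof -
    have [measurable]: "Measurable.pred borel (\<lambda>u. good (C u))"
      using meas_good by (simp add: pred_def)
    show ?thesis unfolding Y_def by measurable
  qed
  have meas_X: "X \<in> borel_measurable borel"
    using borel_measurable_LIMSEQ_metric[OF meas_Y X(1)] .
  define l where "l = Abs_borel_prob (distr unit_uniform borel X)"
  have l: "borel_measure l = distr unit_uniform borel X"
    unfolding l_def using meas_X by (intro Abs_borel_prob_inverse) (auto intro!: U.prob_space_distr)
  interpret L: prob_space "borel_measure l" by (rule prob_space_borel_measure)
  have "(\<lambda>n. \<nu> (r n)) \<longlonglongrightarrow> l"
  proof (rule tendstoI)
    fix e' :: real assume "0 < e'"
    \<comment> \<open>Admissibility of \<open>e\<close> bounds the distance only by
      \<open>e\<close>; halving \<open>e'\<close> makes the final inequality strict.\<close>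
    define e where "e = e' / 2"
    have e: "0 < e" "e < e'" using \<open>0 < e'\<close> by (auto simp: e_def)
    \<comment> \<open>Two radii of level \<open>k\<close> must add up to less than \<open>e\<close>,
      since a point of \<open>B\<close> and \<open>X u\<close> will be compared through a common
      centre.\<close>
    obtain k where k: "(1/2::real)^k < e / 2"
      using real_arch_pow_inv[of "e/2" "1/2"] e by auto
    obtain N J where J: "\<And>i. i < N \<Longrightarrow> prod_encode (k, i) < J"
      and N: "\<And>n. 1 - e / 2 < measure (borel_measure (\<nu> n)) (\<Union>i<N. A (prod_encode (k, i)))"
      using cover[of "e/2" k] e by auto
    let ?G = "\<Union>i<N. A (prod_encode (k, i))"
    have sets_G: "?G \<in> sets borel" using sets_A by auto
    have "\<forall>\<^sub>F n in sequentially. \<forall>S. \<bar>measure (borel_measure (\<nu> (r n))) {y. ?c y \<inter> {..<J} \<in> S}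
        - measure unit_uniform {u. C u \<inter> {..<J} \<in> S}\<bar> < e / 2"
      using e by (intro conv) auto
    then show "\<forall>\<^sub>F n in sequentially. dist (\<nu> (r n)) l < e'"
    proof eventually_elim
      case (elim n)
      let ?\<nu> = "borel_measure (\<nu> (r n))"
      have "measure ?\<nu> B \<le> measure (borel_measure l) (enlargement B e) + e" if "closed B" for B
      proof -
        \<comment> \<open>The truncated codes of the points of \<open>B\<close> in
          \<open>?G\<close>. The resulting event is measurable and controlled by \<open>elim\<close>
          whatever \<open>B\<close> is. One half of \<open>e\<close> pays for the mass outside
          \<open>?G\<close>, the other for the error in \<open>elim\<close>.\<close>
        let ?S = "{T. \<exists>y\<in>B. ?c y \<inter> {..<J} = T \<and> (\<exists>i<N. prod_encode (k, i) \<in> T)}"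
        have sets_S: "{y. ?c y \<inter> {..<J} \<in> ?S} \<in> sets ?\<nu>"
          using trunc_c[of J ?S] by simp
        have "B \<subseteq> {y. ?c y \<inter> {..<J} \<in> ?S} \<union> (UNIV - ?G)"
          using J by fastforce
        then have "measure ?\<nu> B \<le> measure ?\<nu> ({y. ?c y \<inter> {..<J} \<in> ?S} \<union> (UNIV - ?G))"
          using sets_S sets_G by (intro N.finite_measure_mono) auto
        also have "\<dots> \<le> measure ?\<nu> {y. ?c y \<inter> {..<J} \<in> ?S} + measure ?\<nu> (UNIV - ?G)"
          using sets_S sets_G by (intro measure_Un_le) auto
        also have "measure ?\<nu> (UNIV - ?G) < e / 2"
          using N.prob_compl[of ?G "r n"] N[of "r n"] sets_G by simp
        also have "measure ?\<nu> {y. ?c y \<inter> {..<J} \<in> ?S}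
            < measure unit_uniform {u. C u \<inter> {..<J} \<in> ?S} + e / 2"
          using elim[rule_format, of ?S] by linarith
        also have "measure unit_uniform {u. C u \<inter> {..<J} \<in> ?S}
            \<le> measure unit_uniform (X -` enlargement B e)"
        proof (rule U.finite_measure_mono_AE)
          show "X -` enlargement B e \<in> sets unit_uniform"
            using measurable_sets[OF meas_X borel_open[OF open_enlargement]] by simp
          show "AE u in unit_uniform. u \<in> {u. C u \<inter> {..<J} \<in> ?S} \<longrightarrow> u \<in> X -` enlargement B e"
            using AE_good
          proof eventually_elim
            case (elim u)
            show ?case
            proof
              assume "u \<in> {u. C u \<inter> {..<J} \<in> ?S}"
              then obtain y i where y: "y \<in> B" "?c y \<inter> {..<J} = C u \<inter> {..<J}"
                and i: "prod_encode (k, i) \<in> C u \<inter> {..<J}" by auto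
              then have "prod_encode (k, i) \<in> ?c y" by blast
              then have "dist (x i) y < (1/2)^k" by simp
              moreover have "dist (X u) (x i) \<le> (1/2)^k"
                using X(2)[OF elim] i by blast
              ultimately have "dist (X u) y < e"
                using k dist_triangle[of "X u" y "x i"] by linarith
              with y(1) show "u \<in> X -` enlargement B e" by (auto simp: enlargement_def)
            qed
          qed
        qed
        also have "measure unit_uniform (X -` enlargement B e) = measure (borel_measure l) (enlargement B e)"
          unfolding l using meas_X by (simp add: measure_distr open_enlargement)
        finally show ?thesis by simp
      qed
      then have "dist (\<nu> (r n)) l \<le> e"
        using e by (intro dist_borel_prob_le prohorov_admissibleI)
      with e show ?case by simp
    qed
  qed
  with r show thesis by (rule that)
qed

subsection \<open>Tightness of relatively compact families\<close>

text \<open>Total boundedness reduces the claim to the finitely many measures in \<open>P\<close>,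
  each of which exhausts the space by finite unions of balls. Prohorov closeness transfers the bound
  to \<open>F\<close>, enlarging the balls and losing a little mass.\<close>

lemma compact_closure_imp_uniform_cover:
  fixes F :: "'a::metric_space borel_prob set"
  assumes F: "compact (closure F)" and x: "\<And>y e. 0 < e \<Longrightarrow> \<exists>i. y \<in> ball (x i) e"
    and "0 < \<delta>" "0 < \<eta>"
  obtains N :: nat where "\<And>\<mu>. \<mu> \<in> F \<Longrightarrow> 1 - \<eta> < measure (borel_measure \<mu>) (\<Union>i<N. cball (x i) \<delta>)"
proof -
  define e where "e = min (\<eta> / 2) (\<delta> / 2)"
  have "0 < e" using assms by (auto simp: e_def)
  then obtain P where P: "finite P" "closure F \<subseteq> (\<Union>\<rho>\<in>P. ball \<rho> e)"
    using F unfolding compact_eq_totally_bounded by metis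
  \<comment> \<open>Closed balls, because admissibility speaks of closed sets; half the radius,
    because an enlargement by less than \<open>e\<close> then stays within radius
    \<open>\<delta>\<close>.\<close>
  let ?A = "\<lambda>N. \<Union>i<N. cball (x i) (\<delta> / 2)"
  have "\<forall>\<^sub>F N in sequentially. 1 - \<eta> / 2 < measure (borel_measure \<rho>) (?A N)" for \<rho> :: "'a borel_prob"
  proof -
    interpret R: prob_space "borel_measure \<rho>" by (rule prob_space_borel_measure)
    have "y \<in> (\<Union>N. ?A N)" for y
    proof -
      obtain i where "y \<in> ball (x i) (\<delta> / 2)" using x[of "\<delta> / 2" y] \<open>0 < \<delta>\<close> by auto
      then have "y \<in> ?A (Suc i)" by (auto simp: less_imp_le intro: bexI[of _ i])
      then show ?thesis by blast
    qed
    then have UN: "(\<Union>N. ?A N) = UNIV" by blast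
    have "(\<lambda>N. measure (borel_measure \<rho>) (?A N)) \<longlonglongrightarrow> measure (borel_measure \<rho>) (\<Union>N. ?A N)"
    proof (rule R.finite_Lim_measure_incseq)
      show "range ?A \<subseteq> sets (borel_measure \<rho>)" by auto
      show "incseq ?A" unfolding incseq_def by (intro allI impI UN_mono) auto
    qed
    then have "(\<lambda>N. measure (borel_measure \<rho>) (?A N)) \<longlonglongrightarrow> 1"
      unfolding UN using R.prob_space by simp
    then show ?thesis using \<open>0 < \<eta>\<close> by (intro order_tendstoD) auto
  qed
  then have "\<forall>\<^sub>F N in sequentially. \<forall>\<rho>\<in>P. 1 - \<eta> / 2 < measure (borel_measure \<rho>) (?A N)"
    using P(1) by (intro eventually_ball_finite) auto
  then obtain N where N: "\<And>\<rho>. \<rho> \<in> P \<Longrightarrow> 1 - \<eta> / 2 < measure (borel_measure \<rho>) (?A N)"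
    unfolding eventually_sequentially by blast
  have "1 - \<eta> < measure (borel_measure \<mu>) (\<Union>i<N. cball (x i) \<delta>)" if "\<mu> \<in> F" for \<mu>
  proof -
    interpret M: prob_space "borel_measure \<mu>" by (rule prob_space_borel_measure)
    obtain \<rho> where \<rho>: "\<rho> \<in> P" "dist \<rho> \<mu> < e"
      using P(2) \<open>\<mu> \<in> F\<close> closure_subset[of F] by auto
    obtain d where d: "prohorov_admissible (borel_measure \<rho>) (borel_measure \<mu>) d" "d < e"
      using \<rho>(2) unfolding dist_borel_prob_def by (rule prohorov_lessD)
    have "closed (?A N)" by auto
    then have "measure (borel_measure \<rho>) (?A N) \<le> measure (borel_measure \<mu>) (enlargement (?A N) d) + d"
      using d(1) unfolding prohorov_admissible_def by blast
    also have "measure (borel_measure \<mu>) (enlargement (?A N) d)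
        \<le> measure (borel_measure \<mu>) (\<Union>i<N. cball (x i) \<delta>)"
    proof (rule M.finite_measure_mono)
      show "enlargement (?A N) d \<subseteq> (\<Union>i<N. cball (x i) \<delta>)"
      proof
        fix y assume "y \<in> enlargement (?A N) d"
        then obtain i w where i: "i < N" "dist (x i) w \<le> \<delta> / 2" "dist y w < d"
          by (auto simp: enlargement_def)
        have "dist (x i) y \<le> \<delta>"
          using i d(2) dist_triangle2[of "x i" y w] by (simp add: e_def)
        with i(1) show "y \<in> (\<Union>i<N. cball (x i) \<delta>)" by auto
      qed
    qed auto
    finally show ?thesis
      using N[OF \<rho>(1)] d(2) by (simp add: e_def)
  qed
  then show thesis by (rule that)
qed

lemma compact_closure_imp_tight:
  fixes F :: "'a::polish_space borel_prob set"
  assumes F: "compact (closure F)"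
  shows "tight_family F"
  unfolding tight_family_def
proof (intro allI impI)
  fix \<epsilon> :: real assume "0 < \<epsilon>"
  obtain x :: "nat \<Rightarrow> 'a" where x: "\<And>y e. 0 < e \<Longrightarrow> \<exists>i. y \<in> ball (x i) e"
    using dense_sequence by blast
  \<comment> \<open>These losses sum over \<open>k\<close> to \<open>\<epsilon> / 2\<close>, which
    leaves room for the strict inequality in tightness.\<close>
  have "\<exists>N. \<forall>\<mu>\<in>F. 1 - \<epsilon> / 4 * (1/2)^k < measure (borel_measure \<mu>) (\<Union>i<N. cball (x i) ((1/2)^k))"
    for k :: nat
  proof -
    have "0 < (1/2::real)^k" "0 < \<epsilon> / 4 * (1/2)^k" using \<open>0 < \<epsilon>\<close> by auto
    from compact_closure_imp_uniform_cover[OF F x this] show ?thesis by metis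
  qed
  then obtain N where N: "\<And>k \<mu>. \<mu> \<in> F \<Longrightarrow>
      1 - \<epsilon> / 4 * (1/2)^k < measure (borel_measure \<mu>) (\<Union>i<N k. cball (x i) ((1/2)^k))"
    by metis
  define G where "G k = (\<Union>i<N k. cball (x i) ((1/2)^k))" for k
  have closed_G: "closed (G k)" for k by (auto simp: G_def)
  \<comment> \<open>A closed subset of a complete space is complete, and total boundedness comes
    from the single set \<open>G k\<close> with \<open>(1/2)^k < e\<close>.\<close>
  have "compact (\<Inter>k. G k)"
    unfolding compact_eq_totally_bounded complete_eq_closed
  proof (intro conjI allI impI)
    show "closed (\<Inter>k. G k)"
      using closed_G by (simp add: closed_INT)
    fix e :: real assume "0 < e"
    then obtain k where k: "(1/2::real)^k < e"
      using real_arch_pow_inv[of e "1/2"] by auto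
    have "(\<Inter>k. G k) \<subseteq> G k" by auto
    also have "\<dots> \<subseteq> (\<Union>y\<in>x ` {..<N k}. ball y e)"
    proof
      fix y assume "y \<in> G k"
      then obtain i where "i < N k" "dist (x i) y \<le> (1/2)^k" by (auto simp: G_def)
      with k have "y \<in> ball (x i) e" "x i \<in> x ` {..<N k}" by auto
      then show "y \<in> (\<Union>y\<in>x ` {..<N k}. ball y e)" by blast
    qed
    finally show "\<exists>S. finite S \<and> (\<Inter>k. G k) \<subseteq> (\<Union>y\<in>S. ball y e)"
      by (intro exI[of _ "x ` {..<N k}"]) auto
  qed
  moreover have "1 - \<epsilon> < measure (borel_measure \<mu>) (\<Inter>k. G k)" if "\<mu> \<in> F" for \<mu>
  proof -
    interpret M: prob_space "borel_measure \<mu>" by (rule prob_space_borel_measure)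
    have sets_G: "G k \<in> sets borel" for k using closed_G by auto
    have compl: "measure (borel_measure \<mu>) (UNIV - G k) \<le> \<epsilon> / 4 * (1/2)^k" for k
      using M.prob_compl[of "G k"] N[OF that, of k] sets_G by (simp add: G_def)
    have summable: "summable (\<lambda>k. \<epsilon> / 4 * (1/2)^k)"
      by (intro summable_mult summable_geometric) simp
    then have summable': "summable (\<lambda>k. measure (borel_measure \<mu>) (UNIV - G k))"
      by (rule summable_comparison_test'[where N = 0]) (use compl in simp)
    have "measure (borel_measure \<mu>) (\<Union>k. UNIV - G k) \<le> (\<Sum>k. measure (borel_measure \<mu>) (UNIV - G k))"
      using sets_G summable' by (intro M.finite_measure_subadditive_countably) auto
    also have "\<dots> \<le> (\<Sum>k. \<epsilon> / 4 * (1/2)^k)"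
      by (rule suminf_le[OF compl summable' summable])
    also have "\<dots> = \<epsilon> / 2"
      by (subst suminf_mult) (auto simp: suminf_geometric summable_geometric)
    also have "(\<Union>k. UNIV - G k) = UNIV - (\<Inter>k. G k)" by auto
    finally show ?thesis
      using M.prob_compl[of "\<Inter>k. G k"] sets_G \<open>0 < \<epsilon>\<close> by auto
  qed
  ultimately show "\<exists>K. compact K \<and> (\<forall>\<mu>\<in>F. 1 - \<epsilon> < measure (borel_measure \<mu>) K)" by blast
qed

lemma tight_family_subset:
  assumes "tight_family F" "G \<subseteq> F"
  shows "tight_family G"
  unfolding tight_family_def
proof (intro allI impI)
  fix \<epsilon> :: real assume "0 < \<epsilon>"
  then obtain K where "compact K" "\<forall>\<mu>\<in>F. 1 - \<epsilon> < measure (borel_measure \<mu>) K"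
    using assms(1) unfolding tight_family_def by auto
  with assms(2) show "\<exists>K. compact K \<and> (\<forall>\<mu>\<in>G. 1 - \<epsilon> < measure (borel_measure \<mu>) K)"
    by auto
qed

theorem theorem2p5:
  fixes F :: "'a::polish_space borel_prob set"
  shows "tight_family F \<longleftrightarrow> compact (closure F)"
proof
  assume F: "tight_family F"
  show "compact (closure F)"
  proof (rule compact_closure_sequentiallyI)
    fix f :: "nat \<Rightarrow> 'a borel_prob" assume "range f \<subseteq> F"
    from F this have "tight_family (range f)" by (rule tight_family_subset)
    then obtain r :: "nat \<Rightarrow> nat" and l where "strict_mono r" "(\<lambda>n. f (r n)) \<longlonglongrightarrow> l"
      by (rule tight_family_imp_convergent_subsequence)
    then show "\<exists>r l. strict_mono (r :: nat \<Rightarrow> nat) \<and> (\<lambda>n. f (r n)) \<longlonglongrightarrow> l"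
      by (intro exI conjI)
  qed
qed (rule compact_closure_imp_tight)

end
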